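(* Let $P$ be a probability measure on $\mathbb S_{++}^d$ and let $\varepsilon>0$. Assume that smoothed Riemannian gradient descent for the geometric median of $P$ is initialized at $\Sigma_0\in\operatorname{supp}P$ and run with step size $\eta=\varepsilon$. Then its iterates satisfy $$\min_{t=0,1,\dots,T}\|\nabla F_\varepsilon(\Sigma_t)\|_{\Sigma_t}\le\varepsilon\qquad\text{if}\qquad T\ge\frac{2F_\varepsilon(\Sigma_0)}{\varepsilon^3}.$$
   Context: $\mathbb S_{++}^d$ is the set of real symmetric positive definite $d\times d$ matrices, identified with non-degenerate centered Gaussians. For $\Sigma,\Sigma'\in\mathbb S_{++}^d$, $W_2^2(\Sigma,\Sigma')=\operatorname{tr}[\Sigma+\Sigma'-2(\Sigma^{1/2}\Sigma'\Sigma^{1/2})^{1/2}]$ is the squared $2$-Wasserstein distance between $\mathcal N(0,\Sigma)$ and $\mathcal N(0,\Sigma')$. Set $W_{2,\varepsilon}=\sqrt{W_2^2+\varepsilon^2}$ and $F_\varepsilon(\Sigma)=\int W_{2,\varepsilon}(\Sigma,\Sigma')\,dP(\Sigma')$. The matrix geometric mean is $\mathrm{GM}(A,B)=A^{1/2}(A^{-1/2}BA^{-1/2})^{1/2}A^{1/2}$; $\mathrm{GM}(\Sigma^{-1},\Sigma')$ is the optimal transport map from $\mathcal N(0,\Sigma)$ to $\mathcal N(0,\Sigma')$. The Bures--Wasserstein gradient of $F_\varepsilon$ is the symmetric matrix $$\nabla F_\varepsilon(\Sigma)=-\int\frac{\mathrm{GM}(\Sigma^{-1},\Sigma')-I_d}{W_{2,\varepsilon}(\Sigma,\Sigma')}\,dP(\Sigma'),$$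 and for a symmetric matrix $S$, $\|S\|_\Sigma=\sqrt{\operatorname{tr}(S\Sigma S)}$. Smoothed Riemannian gradient descent with step size $\eta$: for $t\ge1$, $\Sigma_t=S_t\Sigma_{t-1}S_t$ with $S_t=I_d-\eta\,\nabla F_\varepsilon(\Sigma_{t-1})$, i.e. $S_t=I_d+\eta\int\{\mathrm{GM}(\Sigma_{t-1}^{-1},\Sigma)-I_d\}\,W_{2,\varepsilon}(\Sigma_{t-1},\Sigma)^{-1}\,dP(\Sigma)$. *)

theory Defs
  imports "HOL-Probability.Probability"
begin

definition psd_matrix :: "real^'n^'n \<Rightarrow> bool" where
  "psd_matrix A \<longleftrightarrow> transpose A = A \<and> (\<forall>x. 0 \<le> x \<bullet> (A *v x))"

definition spd_matrices :: "(real^'n^'n) set" where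
  "spd_matrices = {A. transpose A = A \<and> (\<forall>x. x \<noteq> 0 \<longrightarrow> 0 < x \<bullet> (A *v x))}"

(* The principal square root; it is only meaningful for positive semidefinite A. *)
definition mat_sqrt :: "real^'n^'n \<Rightarrow> real^'n^'n" where
  "mat_sqrt A = (THE B. psd_matrix B \<and> B ** B = A)"

definition geo_mean :: "real^'n^'n \<Rightarrow> real^'n^'n \<Rightarrow> real^'n^'n" where
  "geo_mean A B =
     mat_sqrt A ** mat_sqrt (matrix_inv (mat_sqrt A) ** B ** matrix_inv (mat_sqrt A)) ** mat_sqrt A"

definition W2_sq :: "real^'n^'n \<Rightarrow> real^'n^'n \<Rightarrow> real" where
  "W2_sq A B = trace (A + B - 2 *\<^sub>R mat_sqrt (mat_sqrt A ** B ** mat_sqrt A))"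

definition W2_eps :: "real \<Rightarrow> real^'n^'n \<Rightarrow> real^'n^'n \<Rightarrow> real" where
  "W2_eps \<epsilon> A B = sqrt (W2_sq A B + \<epsilon>\<^sup>2)"

(* No moment condition is imposed on P, so the objective may be infinite and is
   therefore extended-valued. *)
definition median_obj :: "(real^'n^'n) measure \<Rightarrow> real \<Rightarrow> real^'n^'n \<Rightarrow> ennreal" where
  "median_obj P \<epsilon> A = (\<integral>\<^sup>+B. ennreal (W2_eps \<epsilon> A B) \<partial>P)"

(* The Bochner integral exists without any moment condition: for positive definite A and B,
   trace ((GM - I) A (GM - I)) = W2_sq A B with GM = geo_mean (matrix_inv A) B, so the
   integrand is bounded in B. *)
definition median_grad :: "(real^'n^'n) measure \<Rightarrow> real \<Rightarrow> real^'n^'n \<Rightarrow> real^'n^'n" where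
  "median_grad P \<epsilon> A =
     - (\<integral>B. (1 / W2_eps \<epsilon> A B) *\<^sub>R (geo_mean (matrix_inv A) B - mat 1) \<partial>P)"

definition bw_norm :: "real^'n^'n \<Rightarrow> real^'n^'n \<Rightarrow> real" where
  "bw_norm A S = sqrt (trace (S ** A ** S))"

definition gd_factor ::
    "(real^'n^'n) measure \<Rightarrow> real \<Rightarrow> real \<Rightarrow> real^'n^'n \<Rightarrow> real^'n^'n" where
  "gd_factor P \<epsilon> \<eta> A = mat 1 - \<eta> *\<^sub>R median_grad P \<epsilon> A"

primrec gd_iter ::
    "(real^'n^'n) measure \<Rightarrow> real \<Rightarrow> real \<Rightarrow> real^'n^'n \<Rightarrow> nat \<Rightarrow> real^'n^'n" where
  "gd_iter P \<epsilon> \<eta> A 0 = A"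
| "gd_iter P \<epsilon> \<eta> A (Suc t) =
     gd_factor P \<epsilon> \<eta> (gd_iter P \<epsilon> \<eta> A t) ** gd_iter P \<epsilon> \<eta> A t
       ** gd_factor P \<epsilon> \<eta> (gd_iter P \<epsilon> \<eta> A t)"

(* Topological support, relative to the subspace topology of the carrier of the measure. *)
definition measure_supp :: "'a::topological_space measure \<Rightarrow> 'a set" where
  "measure_supp M = {x \<in> space M. \<forall>U. open U \<longrightarrow> x \<in> U \<longrightarrow> 0 < emeasure M (U \<inter> space M)}"

end

theory Submission
  imports Defs
begin

text \<open>
Gradient descent with step size \<open>\<epsilon>\<close> decreases \<open>F\<^sub>\<epsilon>\<close> by at least \<open>\<epsilon> / 2\<close> times the squared gradient norm.
If the norm exceeded \<open>\<epsilon>\<close> at all the times \<open>0, ..., T\<close>, these \<open>T + 1\<close> steps would decrease the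
nonnegative function \<open>F\<^sub>\<epsilon>\<close> by more than \<open>(T + 1) \<epsilon>\<^sup>3 / 2\<close>, which contradicts
\<open>T \<ge> 2 F\<^sub>\<epsilon>(\<Sigma>\<^sub>0) / \<epsilon>\<^sup>3\<close>.

The decrease in one step (\<open>median_obj_descent\<close>) comes from one explicit coupling. Let \<open>T\<close>
be the optimal map from \<open>A\<close> to \<open>B\<close>, \<open>G\<close> the gradient at \<open>A\<close>, and \<open>S = I - \<eta> G\<close>. If \<open>X\<close> has covariance
\<open>A\<close>, then \<open>(S X, T X)\<close> couples the new iterate \<open>S A S\<close> with \<open>B\<close>, so that
\<open>W\<^sub>2\<^sup>2(S A S, B) \<le> tr ((T - S) A (T - S)) = W\<^sub>2\<^sup>2(A, B) + 2 \<eta> tr ((T - I) A G) + \<eta>\<^sup>2 tr (G A G)\<close>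
(\<open>W2_sq_coupling\<close>). By concavity of the square root the smoothed distance grows by at most half of
the last two terms divided by \<open>W\<^sub>2\<^sub>,\<^sub>\<epsilon>(A, B)\<close>, which is at least \<open>\<epsilon>\<close>. Integrating over \<open>B\<close> turns the linear term into
\<open>- \<eta> \<parallel>G\<parallel>\<^sup>2\<close> by the definition of \<open>G\<close>, and the quadratic one contributes at most \<open>\<eta>\<^sup>2 \<parallel>G\<parallel>\<^sup>2 / (2 \<epsilon>)\<close>.

Two points have to be secured for this argument. The iterates must remain positive definite
(\<open>gd_factor_spd\<close>): for \<open>\<eta> \<le> \<epsilon>\<close> the matrix \<open>S\<close> is a mean of convex combinations of \<open>I\<close> and positive definite
transport maps. The gradient must be a genuine integral: its integrand is bounded, since the displacement
\<open>T - I\<close> is controlled by the distance, and it is measurable, since the matrix square root is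
continuous. Existence, uniqueness and continuity of the square root are derived from the
contraction principle (\<open>spd_square_root_exists\<close>) and one trace estimate
(\<open>square_root_stability\<close>).
\<close>

section \<open>Matrix algebra\<close>

lemma bounded_bilinear_matrix_mult:
  "bounded_bilinear ((**) :: real^'n^'m \<Rightarrow> real^'k^'n \<Rightarrow> real^'k^'m)"
  unfolding bilinear_conv_bounded_bilinear[symmetric] bilinear_def
  by (auto intro!: linearI simp: matrix_add_ldistrib matrix_scalar_ac
      scalar_matrix_assoc[symmetric] matrix_matrix_mult_def vec_eq_iff
      sum.distrib sum_distrib_left algebra_simps)

lemmas matrix_mult_diff_left = bounded_bilinear.diff_left[OF bounded_bilinear_matrix_mult]
lemmas matrix_mult_diff_right = bounded_bilinear.diff_right[OF bounded_bilinear_matrix_mult]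
lemmas matrix_mult_add_left = bounded_bilinear.add_left[OF bounded_bilinear_matrix_mult]
lemmas matrix_mult_add_right = bounded_bilinear.add_right[OF bounded_bilinear_matrix_mult]
lemmas matrix_mult_minus_left = bounded_bilinear.minus_left[OF bounded_bilinear_matrix_mult]
lemmas matrix_mult_scaleR_left = bounded_bilinear.scaleR_left[OF bounded_bilinear_matrix_mult]
lemmas matrix_mult_scaleR_right = bounded_bilinear.scaleR_right[OF bounded_bilinear_matrix_mult]
lemmas continuous_on_matrix_mult =
  bounded_bilinear.continuous_on[OF bounded_bilinear_matrix_mult]
lemmas matrix_ring_simps =
  matrix_mult_diff_left matrix_mult_diff_right matrix_mult_add_left matrix_mult_add_right
  matrix_mult_scaleR_left matrix_mult_scaleR_right matrix_mul_assoc

lemma bounded_linear_transpose: "bounded_linear (transpose :: real^'n^'m \<Rightarrow> real^'m^'n)"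
  unfolding linear_conv_bounded_linear[symmetric]
  by (auto intro!: linearI simp: transpose_def vec_eq_iff)

lemma transpose_diff: "transpose (A - B) = transpose A - transpose (B :: real^'n^'m)"
  by (simp add: transpose_def vec_eq_iff)

lemma bounded_linear_trace: "bounded_linear (trace :: real^'n^'n \<Rightarrow> real)"
  unfolding linear_conv_bounded_linear[symmetric]
  by (auto intro!: linearI simp: trace_add) (simp add: trace_def sum_distrib_left)

lemma trace_scaleR: "trace (c *\<^sub>R A) = c * trace (A :: real^'n^'n)"
  by (simp add: trace_def sum_distrib_left)

lemma trace_transpose: "trace (transpose A) = trace A"
  by (simp add: trace_def transpose_def)

lemma inner_matrix_eq_trace: "M \<bullet> N = trace (M ** transpose (N :: real^'n^'m))"
  by (simp add: inner_vec_def trace_def matrix_matrix_mult_def transpose_def)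

lemma norm_matrix_power2: "(norm (M :: real^'n^'m))\<^sup>2 = (\<Sum>i\<in>UNIV. (norm (M $ i))\<^sup>2)"
  by (simp add: power2_norm_eq_inner inner_vec_def)

lemma norm_transpose: "norm (transpose M) = norm (M :: real^'n^'m)"
proof -
  have "(norm (transpose M))\<^sup>2 = (norm M)\<^sup>2"
    unfolding power2_norm_eq_inner inner_matrix_eq_trace
    by (simp add: trace_mul_sym[of "transpose M"])
  then show ?thesis by simp
qed

lemma inner_symmetric_matrix:
  "transpose A = A \<Longrightarrow> (A *v x) \<bullet> y = x \<bullet> ((A :: real^'n^'n) *v y)"
  by (metis dot_lmul_matrix transpose_matrix_vector)

text \<open>The rows \<open>v\<close> of \<open>V\<close> turn the trace into a sum of values \<open>v \<bullet> (A *v v)\<close> of the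
quadratic form. Hence every pointwise lower bound on the form becomes a bound on the trace.\<close>

lemma trace_congruence:
  "trace (V ** A ** transpose V) = (\<Sum>i\<in>UNIV. V $ i \<bullet> (A *v (V $ i)))"
  for A :: "real^'n^'n" and V :: "real^'n^'m"
proof -
  have "(V ** A ** transpose V) $ i $ i = V $ i \<bullet> (A *v (V $ i))" for i
    unfolding matrix_mul_assoc[symmetric]
    by (simp add: matrix_matrix_mult_def inner_vec_def matrix_vector_mult_def transpose_def)
  then show ?thesis by (simp add: trace_def)
qed

lemma trace_congruence_ge:
  fixes A :: "real^'n^'n" and V :: "real^'n^'m"
  assumes "\<And>x. m * (norm x)\<^sup>2 \<le> x \<bullet> (A *v x)"
  shows "m * (norm V)\<^sup>2 \<le> trace (V ** A ** transpose V)"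
  unfolding trace_congruence norm_matrix_power2 sum_distrib_left
  by (intro sum_mono assms)

lemma trace_congruence_nonneg:
  fixes A :: "real^'n^'n" and V :: "real^'n^'m"
  assumes "\<And>x. 0 \<le> x \<bullet> (A *v x)"
  shows "0 \<le> trace (V ** A ** transpose V)"
  using trace_congruence_ge[of 0 A V] assms by simp

text \<open>If \<open>X\<close> is a centred random vector with covariance \<open>A\<close>, this is the expansion of the mean square
of \<open>T X - S X\<close>.\<close>

lemma trace_diff_congruence:
  fixes A S T :: "real^'n^'n"
  assumes "transpose A = A" "transpose S = S" "transpose T = T"
  shows "trace ((T - S) ** A ** (T - S)) =
    trace (T ** A ** T) + trace (S ** A ** S) - 2 * trace (S ** A ** T)"
proof -
  have "trace (T ** A ** S) = trace (S ** A ** T)"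
    using trace_transpose[of "T ** A ** S"] assms by (simp add: matrix_transpose_mul matrix_mul_assoc)
  then show ?thesis by (simp add: matrix_ring_simps trace_sub)
qed

section \<open>Positive definite matrices\<close>

lemma spd_symmetric: "A \<in> spd_matrices \<Longrightarrow> transpose A = A"
  by (simp add: spd_matrices_def)

lemma spd_pos: "A \<in> spd_matrices \<Longrightarrow> x \<noteq> 0 \<Longrightarrow> 0 < x \<bullet> (A *v x)"
  by (simp add: spd_matrices_def)

lemma spd_nonneg: "A \<in> spd_matrices \<Longrightarrow> 0 \<le> x \<bullet> (A *v x)"
  by (cases "x = 0") (auto dest: spd_pos intro: less_imp_le)

lemma spd_imp_psd: "A \<in> spd_matrices \<Longrightarrow> psd_matrix A"
  by (simp add: psd_matrix_def spd_symmetric spd_nonneg)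

text \<open>The constant is the smallest eigenvalue, obtained as the minimum of the quadratic form on the
unit sphere.\<close>

lemma spd_lower_bound:
  fixes A :: "real^'n^'n"
  assumes A: "A \<in> spd_matrices"
  obtains m where "m > 0" "\<And>x. m * (norm x)\<^sup>2 \<le> x \<bullet> (A *v x)"
proof -
  have "sphere (0 :: real^'n) 1 \<noteq> {}" by (metis norm_axis_1 mem_sphere_0 empty_iff)
  moreover have "continuous_on (sphere 0 1) (\<lambda>x. x \<bullet> (A *v x))"
    by (intro continuous_intros linear_continuous_on) auto
  ultimately obtain u where u: "u \<in> sphere 0 1"
    and min: "\<And>y. y \<in> sphere 0 1 \<Longrightarrow> u \<bullet> (A *v u) \<le> y \<bullet> (A *v y)"
    using continuous_attains_inf[OF compact_sphere] by blast
  show ?thesis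
  proof (rule that)
    show "u \<bullet> (A *v u) > 0" using u by (intro spd_pos[OF A]) auto
    fix x :: "real^'n"
    show "u \<bullet> (A *v u) * (norm x)\<^sup>2 \<le> x \<bullet> (A *v x)"
    proof (cases "x = 0")
      case False
      define y where "y = (1 / norm x) *\<^sub>R x"
      have x: "x = norm x *\<^sub>R y" using False by (simp add: y_def)
      have "u \<bullet> (A *v u) \<le> y \<bullet> (A *v y)" using False by (intro min) (simp add: y_def)
      then have "(norm x)\<^sup>2 * (u \<bullet> (A *v u)) \<le> (norm x)\<^sup>2 * (y \<bullet> (A *v y))"
        by (intro mult_left_mono) auto
      also have "\<dots> = x \<bullet> (A *v x)"
        by (metis (no_types, lifting) x inner_scaleR_left inner_scaleR_right matrix_vector_mult_scaleR
            mult.assoc power2_eq_square)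
      finally show ?thesis by (simp add: mult.commute)
    qed simp
  qed
qed

lemma spd_inverse:
  fixes A :: "real^'n^'n"
  assumes A: "A \<in> spd_matrices"
  shows "matrix_inv A ** A = mat 1" "A ** matrix_inv A = mat 1" "matrix_inv A \<in> spd_matrices"
proof -
  have "x = 0" if "A *v x = 0" for x using spd_pos[OF A, of x] that by auto
  then have "invertible A"
    unfolding invertible_left_inverse matrix_left_invertible_ker by blast
  then have "A ** matrix_inv A = mat 1 \<and> matrix_inv A ** A = mat 1"
    unfolding invertible_def matrix_inv_def by (rule someI_ex)
  then show l: "matrix_inv A ** A = mat 1" and r: "A ** matrix_inv A = mat 1" by auto
  have t: "transpose (matrix_inv A) = matrix_inv A"
  proof -
    have "transpose (matrix_inv A) ** A = mat 1"
      using arg_cong[OF r, of transpose] by (simp add: matrix_transpose_mul spd_symmetric[OF A])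
    then have "transpose (matrix_inv A) ** A ** matrix_inv A = matrix_inv A" by simp
    then show ?thesis by (simp add: matrix_mul_assoc[symmetric] r)
  qed
  have "0 < x \<bullet> (matrix_inv A *v x)" if "x \<noteq> 0" for x
  proof -
    define y where "y = matrix_inv A *v x"
    have x: "x = A *v y" by (simp add: y_def matrix_vector_mul_assoc r)
    then have "y \<noteq> 0" using that by auto
    from spd_pos[OF A this] show ?thesis
      by (simp add: x[symmetric] y_def[symmetric] inner_commute)
  qed
  with t show "matrix_inv A \<in> spd_matrices" by (simp add: spd_matrices_def)
qed

lemma matrix_inv_unique: "A ** B = mat 1 \<Longrightarrow> matrix_inv A = (B :: real^'n^'n)"
proof -
  assume AB: "A ** B = mat 1"
  then have BA: "B ** A = mat 1" by (rule matrix_left_right_inverse1)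
  have "A ** matrix_inv A = mat 1 \<and> matrix_inv A ** A = mat 1"
    unfolding matrix_inv_def by (rule someI[where x = B]) (use AB BA in simp)
  then have "matrix_inv A = matrix_inv A ** (A ** B)" using AB by simp
  also have "\<dots> = (matrix_inv A ** A) ** B" by (simp add: matrix_mul_assoc)
  also have "\<dots> = B" using \<open>_ \<and> _\<close> by simp
  finally show ?thesis .
qed

lemma spd_congruence:
  assumes A: "A \<in> spd_matrices" and R: "R \<in> spd_matrices"
  shows "R ** A ** R \<in> spd_matrices"
proof -
  have "0 < x \<bullet> ((R ** A ** R) *v x)" if "x \<noteq> 0" for x
  proof -
    have "R *v x \<noteq> 0" using spd_pos[OF R that] by auto
    then have "0 < (R *v x) \<bullet> (A *v (R *v x))" by (rule spd_pos[OF A])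
    then show ?thesis
      by (simp add: inner_symmetric_matrix[OF spd_symmetric[OF R]] matrix_vector_mul_assoc
          matrix_mul_assoc)
  qed
  then show ?thesis
    by (simp add: spd_matrices_def matrix_transpose_mul spd_symmetric[OF A] spd_symmetric[OF R]
        matrix_mul_assoc)
qed

section \<open>The square root\<close>

text \<open>With \<open>D = B - Y\<close> one has \<open>B\<^sup>2 - Y\<^sup>2 = B D + D Y\<close>. Taking the inner product with \<open>D\<close> gives
\<open>tr (D B D) + tr (D Y D)\<close>, where the first term is nonnegative and the second at least
\<open>m \<parallel>D\<parallel>\<^sup>2\<close>; the Cauchy--Schwarz inequality concludes. The estimate serves twice: for equal squares
it is the uniqueness of the square root, and otherwise it is its local Lipschitz continuity.\<close>

lemma square_root_stability:
  fixes B Y :: "real^'n^'n"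
  assumes B: "psd_matrix B" and Y: "transpose Y = Y" "\<And>x. m * (norm x)\<^sup>2 \<le> x \<bullet> (Y *v x)"
  shows "m * norm (B - Y) \<le> norm (B ** B - Y ** Y)"
proof (cases "B = Y")
  case False
  define D where "D = B - Y"
  have D: "transpose D = D" using B Y by (simp add: D_def transpose_diff psd_matrix_def)
  have E: "B ** B - Y ** Y = B ** D + D ** Y" by (simp add: D_def matrix_ring_simps)
  have "m * (norm D)\<^sup>2 \<le> trace (D ** B ** D) + trace (D ** Y ** D)"
    using trace_congruence_nonneg[of B D] trace_congruence_ge[of m Y D] B Y D
    by (force simp: psd_matrix_def)
  also have "\<dots> = trace (D ** (B ** B - Y ** Y))"
    by (simp add: E matrix_ring_simps trace_add) (metis matrix_mul_assoc trace_mul_sym)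
  also have "\<dots> = D \<bullet> (B ** B - Y ** Y)"
    using B Y by (simp add: inner_matrix_eq_trace transpose_diff matrix_transpose_mul psd_matrix_def)
  also have "\<dots> \<le> norm D * norm (B ** B - Y ** Y)" by (rule norm_cauchy_schwarz)
  finally have "norm D * (m * norm D) \<le> norm D * norm (B ** B - Y ** Y)"
    by (simp add: power2_eq_square algebra_simps)
  then show ?thesis using False by (simp add: D_def)
qed simp

lemma norm_matrix_mult_le:
  fixes Z :: "real^'n^'n" and D :: "real^'n^'n"
  assumes Z: "transpose Z = Z" and q: "0 \<le> q" "\<And>x. norm (Z *v x) \<le> q * norm x"
  shows "norm (D ** Z) \<le> q * norm D" "norm (Z ** D) \<le> q * norm D"
proof -
  have right: "norm (D ** Z) \<le> q * norm D" for D :: "real^'n^'n"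
  proof -
    have row: "(D ** Z) $ i = Z *v (D $ i)" for i
      by (subst Z[symmetric]) (simp add: matrix_matrix_mult_def vector_matrix_mult_def vec_eq_iff mult.commute)
    have "(norm (D ** Z))\<^sup>2 \<le> (\<Sum>i\<in>UNIV. (q * norm (D $ i))\<^sup>2)"
      unfolding norm_matrix_power2 row by (intro sum_mono power_mono q norm_ge_zero)
    also have "\<dots> = (q * norm D)\<^sup>2"
      by (simp add: norm_matrix_power2 power_mult_distrib sum_distrib_left)
    finally show ?thesis using q by (auto intro: power2_le_imp_le)
  qed
  show "norm (D ** Z) \<le> q * norm D" by (rule right)
  show "norm (Z ** D) \<le> q * norm D"
    using right[of "transpose D"] norm_transpose[of "Z ** D"]
    by (simp add: matrix_transpose_mul Z norm_transpose)
qed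

text \<open>Since \<open>\<parallel>x - A x / c\<parallel>\<^sup>2 = \<parallel>x\<parallel>\<^sup>2 - 2 (x \<bullet> A x) / c + \<parallel>A x\<parallel>\<^sup>2 / c\<^sup>2\<close>, the positive lower bound of the form
wins over the quadratic term as soon as \<open>c\<close> is large.\<close>

lemma spd_rescaled_contraction:
  fixes A :: "real^'n^'n"
  assumes A: "A \<in> spd_matrices"
  obtains c q where "c > 0" "0 \<le> q" "q < 1" "\<And>x. norm (x - (1 / c) *\<^sub>R (A *v x)) \<le> q * norm x"
proof -
  obtain m where m: "m > 0" "\<And>x. m * (norm x)\<^sup>2 \<le> x \<bullet> (A *v x)"
    using spd_lower_bound[OF A] by blast
  obtain K0 where K0: "\<And>x. norm (A *v x) \<le> norm x * K0"
    using bounded_linear.bounded[OF matrix_vector_mul_bounded_linear[of A]] by blast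
  define K where "K = max K0 m"
  have K: "K > 0" "m \<le> K" using m by (auto simp: K_def)
  have AK: "norm (A *v x) \<le> K * norm x" for x
    using K0[of x] mult_left_mono[of K0 K "norm x"] by (simp add: K_def mult.commute)
  \<comment> \<open>This \<open>c\<close> minimises the bound \<open>1 - 2 * m / c + K\<^sup>2 / c\<^sup>2\<close> on the squared factor.\<close>
  define c where "c = K\<^sup>2 / m"
  define q where "q = sqrt (1 - m\<^sup>2 / K\<^sup>2)"
  have c: "c > 0" using K m by (simp add: c_def)
  have mK: "m\<^sup>2 / K\<^sup>2 \<le> 1" "0 < m\<^sup>2 / K\<^sup>2" using K m by (auto simp: power_mono)
  show ?thesis
  proof (rule that[OF c])
    show "0 \<le> q" "q < 1" using mK by (auto simp: q_def)
    fix x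
    have "(norm (x - (1 / c) *\<^sub>R (A *v x)))\<^sup>2
        = (norm x)\<^sup>2 - 2 / c * (x \<bullet> (A *v x)) + (norm (A *v x))\<^sup>2 / c\<^sup>2"
      unfolding power2_norm_eq_inner
      by (simp add: inner_diff_left inner_diff_right inner_commute power2_eq_square)
    also have "\<dots> \<le> (norm x)\<^sup>2 - 2 / c * (m * (norm x)\<^sup>2) + (K * norm x)\<^sup>2 / c\<^sup>2"
      using c m(2)[of x] by (intro add_mono diff_mono mult_left_mono divide_right_mono power_mono AK) auto
    also have "\<dots> = (1 - m\<^sup>2 / K\<^sup>2) * (norm x)\<^sup>2"
      using m K by (simp add: c_def field_simps power2_eq_square)
    also have "\<dots> = (q * norm x)\<^sup>2" using mK by (simp add: q_def power_mult_distrib)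
    finally show "norm (x - (1 / c) *\<^sub>R (A *v x)) \<le> q * norm x"
      using \<open>0 \<le> q\<close> by (auto intro: power2_le_imp_le)
  qed
qed

text \<open>With \<open>X = I - A / c\<close> as above, \<open>(I - Z)\<^sup>2 = A / c\<close> is the fixed point equation \<open>Z = (X + Z\<^sup>2) / 2\<close>.
On the symmetric matrices of operator norm at most \<open>q < 1\<close> its right-hand side is a contraction,
because \<open>Z\<^sup>2 - W\<^sup>2 = Z (Z - W) + (Z - W) W\<close>. The norm bound on the fixed point makes \<open>I - Z\<close>
positive definite.\<close>

lemma spd_square_root_exists:
  fixes A :: "real^'n^'n"
  assumes A: "A \<in> spd_matrices"
  shows "\<exists>Y \<in> spd_matrices. Y ** Y = A"
proof -
  obtain c q where c: "c > 0" and q: "0 \<le> q" "q < 1"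
    and X0: "\<And>x. norm (x - (1 / c) *\<^sub>R (A *v x)) \<le> q * norm x"
    using spd_rescaled_contraction[OF A] by blast
  define X where "X = mat 1 - (1 / c) *\<^sub>R A"
  have Xt: "transpose X = X"
    by (simp add: X_def transpose_diff transpose_scalar spd_symmetric[OF A])
  have X: "norm (X *v x) \<le> q * norm x" for x
    using X0[of x] by (simp add: X_def matrix_vector_mult_diff_rdistrib scaleR_matrix_vector_assoc)
  define S where "S = {Z :: real^'n^'n. transpose Z = Z \<and> (\<forall>x. norm (Z *v x) \<le> q * norm x)}"
  define f where "f Z = (1 / 2) *\<^sub>R (X + Z ** Z)" for Z :: "real^'n^'n"
  have cl: "closed S"
  proof -
    have v: "bounded_linear (\<lambda>Z :: real^'n^'n. Z *v x)" for x
      unfolding linear_conv_bounded_linear[symmetric]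
      by (auto intro!: linearI simp: matrix_vector_mult_add_rdistrib scaleR_matrix_vector_assoc)
    show ?thesis unfolding S_def
      by (intro closed_Collect_conj closed_Collect_all closed_Collect_eq closed_Collect_le
          continuous_intros linear_continuous_on bounded_linear_transpose v)
  qed
  have "f Z \<in> S" if Z: "Z \<in> S" for Z
  proof -
    have "norm (f Z *v x) \<le> q * norm x" for x
    proof -
      have "norm (Z *v (Z *v x)) \<le> q * norm (Z *v x)" using Z by (simp add: S_def)
      also have "\<dots> \<le> 1 * norm (Z *v x)" using q by (intro mult_right_mono) auto
      also have "\<dots> \<le> q * norm x" using Z by (simp add: S_def)
      finally have "norm (X *v x + Z *v (Z *v x)) \<le> q * norm x + q * norm x"
        using X[of x] by (intro norm_triangle_le) simp
      then show ?thesis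
        by (simp add: f_def scaleR_matrix_vector_assoc[symmetric] matrix_vector_mult_add_rdistrib
            matrix_vector_mul_assoc)
    qed
    moreover have "transpose (f Z) = f Z"
      using Z by (simp add: f_def S_def transpose_scalar matrix_transpose_mul Xt
          linear_add[OF bounded_linear.linear[OF bounded_linear_transpose]])
    ultimately show ?thesis by (simp add: S_def)
  qed
  then have "f ` S \<subseteq> S" by blast
  moreover have "dist (f Z) (f W) \<le> q * dist Z W" if "Z \<in> S" "W \<in> S" for Z W
  proof -
    have "f Z - f W = (1 / 2) *\<^sub>R (Z ** (Z - W) + (Z - W) ** W)"
      by (simp add: f_def matrix_ring_simps algebra_simps)
    then have "norm (f Z - f W) \<le> 1 / 2 * (norm (Z ** (Z - W)) + norm ((Z - W) ** W))"
      by (simp add: norm_triangle_ineq)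
    also have "\<dots> \<le> 1 / 2 * (q * norm (Z - W) + q * norm (Z - W))"
      using that q by (intro mult_left_mono add_mono norm_matrix_mult_le) (auto simp: S_def)
    finally show ?thesis by (simp add: dist_norm)
  qed
  moreover have "S \<noteq> {}" using X Xt by (auto simp: S_def)
  ultimately obtain Z where Z: "Z \<in> S" "f Z = Z"
    using Banach_fix[of S q f] q cl by (metis complete_eq_closed)
  define Y where "Y = sqrt c *\<^sub>R (mat 1 - Z)"
  have "2 *\<^sub>R Z = X + Z ** Z" by (subst (1) Z(2)[symmetric]) (simp add: f_def)
  then have "(mat 1 - Z) ** (mat 1 - Z) = (1 / c) *\<^sub>R A"
    by (simp add: matrix_ring_simps X_def algebra_simps scaleR_2)
  then have "Y ** Y = A"
    using c by (simp add: Y_def matrix_mult_scaleR_left matrix_mult_scaleR_right)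
  moreover have "Y \<in> spd_matrices"
  proof -
    have "0 < x \<bullet> (Y *v x)" if x: "x \<noteq> 0" for x
    proof -
      have "x \<bullet> (Z *v x) \<le> norm x * norm (Z *v x)" by (rule norm_cauchy_schwarz)
      also have "\<dots> \<le> norm x * (q * norm x)" using Z by (intro mult_left_mono) (auto simp: S_def)
      also have "\<dots> < x \<bullet> x"
        using q x by (simp add: power2_norm_eq_inner[symmetric] power2_eq_square)
      finally have "0 < sqrt c * (x \<bullet> x - x \<bullet> (Z *v x))" using c by simp
      then show ?thesis
        by (simp add: Y_def scaleR_matrix_vector_assoc[symmetric] matrix_vector_mult_diff_rdistrib
            inner_diff_right)
    qed
    moreover have "transpose Y = Y"
      using Z by (simp add: Y_def S_def transpose_scalar transpose_diff)
    ultimately show ?thesis by (simp add: spd_matrices_def)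
  qed
  ultimately show ?thesis by blast
qed

lemma mat_sqrt_unique:
  fixes B :: "real^'n^'n"
  assumes B: "B \<in> spd_matrices"
  shows "mat_sqrt (B ** B) = B"
  unfolding mat_sqrt_def
proof (rule the_equality)
  fix C :: "real^'n^'n"
  assume C: "psd_matrix C \<and> C ** C = B ** B"
  obtain m where m: "m > 0" "\<And>x. m * (norm x)\<^sup>2 \<le> x \<bullet> (B *v x)"
    using spd_lower_bound[OF B] by blast
  have "m * norm (C - B) \<le> 0"
    using square_root_stability[of C B m] C m spd_symmetric[OF B] by simp
  then show "C = B" using m by (simp add: mult_le_0_iff)
qed (simp add: spd_imp_psd[OF B])

lemma mat_sqrt_spd:
  assumes A: "A \<in> spd_matrices"
  shows "mat_sqrt A \<in> spd_matrices" "mat_sqrt A ** mat_sqrt A = A"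
  using spd_square_root_exists[OF A] by (auto simp: mat_sqrt_unique)

lemma continuous_on_mat_sqrt: "continuous_on spd_matrices mat_sqrt"
  unfolding continuous_on_iff
proof (intro ballI allI impI)
  fix A :: "real^'n^'n" and e :: real
  assume A: "A \<in> spd_matrices" and e: "0 < e"
  obtain m where m: "m > 0" "\<And>x. m * (norm x)\<^sup>2 \<le> x \<bullet> (mat_sqrt A *v x)"
    using spd_lower_bound[OF mat_sqrt_spd(1)[OF A]] by blast
  have "m * dist (mat_sqrt A') (mat_sqrt A) \<le> dist A' A" if "A' \<in> spd_matrices" for A'
    using square_root_stability[of "mat_sqrt A'" "mat_sqrt A" m] m
      mat_sqrt_spd[OF that] mat_sqrt_spd[OF A]
    by (simp add: dist_norm spd_imp_psd spd_symmetric)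
  then show "\<exists>d>0. \<forall>A'\<in>spd_matrices. dist A' A < d \<longrightarrow> dist (mat_sqrt A') (mat_sqrt A) < e"
    using m e by (intro exI[of _ "m * e"]) (fastforce dest: le_less_trans)
qed

section \<open>Optimal transport between centred Gaussians\<close>

text \<open>With \<open>R = A\<^sup>1\<^sup>/\<^sup>2\<close> the map is \<open>T = R\<^sup>-\<^sup>1 M R\<^sup>-\<^sup>1\<close> for \<open>M = (R B R)\<^sup>1\<^sup>/\<^sup>2\<close>; everything follows by
cancelling \<open>R\<close> against its inverse.\<close>

lemma transport_map:
  fixes A B :: "real^'n^'n"
  assumes A: "A \<in> spd_matrices" and B: "B \<in> spd_matrices"
  defines "T \<equiv> geo_mean (matrix_inv A) B"
  shows "T \<in> spd_matrices" "T ** A ** T = B"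
    "W2_sq A B = trace A + trace B - 2 * trace (T ** A)"
proof -
  define R where "R = mat_sqrt A"
  define Q where "Q = matrix_inv R"
  define M where "M = mat_sqrt (R ** B ** R)"
  have R: "R \<in> spd_matrices" "R ** R = A"
    using mat_sqrt_spd[OF A] by (auto simp: R_def)
  have Q: "Q \<in> spd_matrices" and QR: "Q ** R = mat 1" and RQ: "R ** Q = mat 1"
    using spd_inverse[OF R(1)] by (auto simp: Q_def)
  have M: "M \<in> spd_matrices" "M ** M = R ** B ** R"
    using mat_sqrt_spd[OF spd_congruence[OF B R(1)]] by (auto simp: M_def)
  have cancel: "X ** Q ** R = X" "X ** R ** Q = X" for X :: "real^'n^'n"
    by (simp_all add: matrix_mul_assoc[symmetric] QR RQ)
  have MM: "X ** M ** M = X ** R ** B ** R" for X :: "real^'n^'n"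
    by (metis M(2) matrix_mul_assoc)
  have "A ** (Q ** Q) = mat 1"
    by (simp add: R(2)[symmetric] matrix_mul_assoc cancel RQ)
  then have "matrix_inv A = Q ** Q" by (rule matrix_inv_unique)
  then have "mat_sqrt (matrix_inv A) = Q" by (simp add: mat_sqrt_unique[OF Q])
  moreover have "matrix_inv Q = R" by (rule matrix_inv_unique) (rule QR)
  ultimately have T: "T = Q ** M ** Q" by (simp add: T_def geo_mean_def M_def)
  show "T \<in> spd_matrices" unfolding T by (rule spd_congruence[OF M(1) Q])
  show "T ** A ** T = B"
    by (simp add: T R(2)[symmetric] matrix_mul_assoc cancel MM QR)
  have "trace (T ** A) = trace (Q ** M ** R)"
    by (simp add: T R(2)[symmetric] matrix_mul_assoc cancel)
  also have "\<dots> = trace M"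
    using trace_mul_sym[of "Q ** M" R] by (simp add: matrix_mul_assoc RQ)
  finally show "W2_sq A B = trace A + trace B - 2 * trace (T ** A)"
    by (simp add: W2_sq_def trace_add trace_sub trace_scaleR R_def[symmetric] M_def[symmetric])
qed

lemma W2_sq_eq:
  fixes A B :: "real^'n^'n"
  assumes A: "A \<in> spd_matrices" and B: "B \<in> spd_matrices"
  defines "D \<equiv> geo_mean (matrix_inv A) B - mat 1"
  shows "W2_sq A B = trace (D ** A ** D)"
proof -
  define T where "T = geo_mean (matrix_inv A) B"
  note T = transport_map[OF A B, folded T_def]
  have "trace (D ** A ** D) = trace B + trace A - 2 * trace (A ** T)"
    unfolding D_def T_def[symmetric]
    using trace_diff_congruence[of A "mat 1" T] T spd_symmetric[OF A] spd_symmetric[OF T(1)]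
    by simp
  then show ?thesis using T(3) by (simp add: trace_mul_sym[of A])
qed

lemma W2_sq_nonneg:
  fixes A B :: "real^'n^'n"
  assumes A: "A \<in> spd_matrices" and B: "B \<in> spd_matrices"
  shows "0 \<le> W2_sq A B"
proof -
  let ?D = "geo_mean (matrix_inv A) B - mat 1"
  have "transpose ?D = ?D"
    by (simp add: transpose_diff spd_symmetric[OF transport_map(1)[OF A B]])
  then show ?thesis
    using W2_sq_eq[OF A B] trace_congruence_nonneg[of A ?D] spd_nonneg[OF A] by simp
qed

text \<open>If \<open>X\<close> has covariance \<open>A\<close>, then \<open>(S X, T X)\<close> couples the two Gaussians, and the right-hand side is
its transport cost. That no coupling is cheaper than the optimal map is shown by duality. Let
\<open>H\<close> be the optimal map from \<open>S A S\<close> to \<open>T A T\<close>. Its inverse \<open>U\<close> is optimal in the opposite direction,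
so that \<open>V = S - U T\<close> vanishes exactly for the optimal coupling. The trace of \<open>H V A V\<^sup>T\<close> is
nonnegative, and expanding it compares \<open>tr (S A T)\<close> with \<open>tr (H S A S)\<close>, the only terms in which
the two costs differ.\<close>

lemma W2_sq_coupling:
  fixes A S T :: "real^'n^'n"
  assumes A: "A \<in> spd_matrices" and S: "S \<in> spd_matrices" and T: "T \<in> spd_matrices"
  shows "W2_sq (S ** A ** S) (T ** A ** T) \<le> trace ((T - S) ** A ** (T - S))"
proof -
  define A' where "A' = S ** A ** S"
  define B where "B = T ** A ** T"
  have A': "A' \<in> spd_matrices" and B: "B \<in> spd_matrices"
    by (auto simp: A'_def B_def intro: spd_congruence A S T)
  define H where "H = geo_mean (matrix_inv A') B"
  note H = transport_map[OF A' B, folded H_def]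
  define U where "U = matrix_inv H"
  have HU: "H ** U = mat 1" and UH: "U ** H = mat 1" and U: "transpose U = U"
    using spd_inverse[OF H(1)] by (auto simp: U_def spd_symmetric)
  define V where "V = S - U ** T"
  define N where "N = V ** A ** transpose V"
  note sym = spd_symmetric[OF A] spd_symmetric[OF S] spd_symmetric[OF T] U
  have HUX: "H ** U ** X = X" for X :: "real^'n^'n" by (simp add: HU)
  have N_eq: "H ** N = H ** A' - T ** A ** S - H ** S ** A ** T ** U + B ** U"
    by (simp add: N_def V_def transpose_diff matrix_transpose_mul sym A'_def B_def
        matrix_ring_simps HU)
  have t1: "trace (H ** S ** A ** T ** U) = trace (S ** A ** T)"
    using trace_mul_sym[of "H ** (S ** A ** T)" U] by (simp add: matrix_mul_assoc UH)
  have t2: "trace (T ** A ** S) = trace (S ** A ** T)"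
    using trace_transpose[of "T ** A ** S"] sym by (simp add: matrix_transpose_mul matrix_mul_assoc)
  have t3: "trace (B ** U) = trace (H ** A')"
    by (simp add: H(2)[symmetric] matrix_mul_assoc[symmetric] HU)
  have N_nonneg: "0 \<le> trace (H ** N)"
  proof -
    define a where "a = mat_sqrt A"
    have a: "transpose a = a" "a ** a = A"
      using mat_sqrt_spd[OF A] by (auto simp: a_def spd_symmetric)
    have "trace (transpose (V ** a) ** H ** transpose (transpose (V ** a))) = trace (H ** N)"
      unfolding N_def a(2)[symmetric]
      using trace_mul_sym[of "transpose (V ** a)" "H ** (V ** a)"] a(1)
      by (simp add: matrix_transpose_mul matrix_mul_assoc)
    then show ?thesis
      using trace_congruence_nonneg[of H "transpose (V ** a)"] spd_nonneg[OF H(1)] by simp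
  qed
  then have "trace (S ** A ** T) \<le> trace (H ** A')"
    unfolding N_eq by (simp add: trace_add trace_sub t1 t2 t3)
  then show ?thesis
    unfolding trace_diff_congruence[OF sym(1-3)] A'_def[symmetric] B_def[symmetric] H(3)
    by simp
qed

text \<open>For fixed \<open>A\<close> the displacement is thus controlled by the distance; dividing by the distance makes
the integrand of the gradient bounded.\<close>

lemma geo_mean_distance_bound:
  fixes A B :: "real^'n^'n"
  assumes A: "A \<in> spd_matrices" and B: "B \<in> spd_matrices"
    and m: "\<And>x. m * (norm x)\<^sup>2 \<le> x \<bullet> (A *v x)"
  shows "m * (norm (geo_mean (matrix_inv A) B - mat 1))\<^sup>2 \<le> W2_sq A B"
proof -
  let ?D = "geo_mean (matrix_inv A) B - mat 1"
  have "transpose ?D = ?D"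
    by (simp add: transpose_diff spd_symmetric[OF transport_map(1)[OF A B]])
  then show ?thesis
    using W2_sq_eq[OF A B] trace_congruence_ge[of m A ?D] m by simp
qed

lemma continuous_on_mat_sqrt_congruence:
  fixes R :: "real^'n^'n"
  assumes "R \<in> spd_matrices"
  shows "continuous_on spd_matrices (\<lambda>B. mat_sqrt (R ** B ** R))"
  by (rule continuous_on_compose2[OF continuous_on_mat_sqrt])
    (auto intro!: continuous_on_matrix_mult continuous_intros spd_congruence assms)

lemma continuous_on_geo_mean:
  fixes A :: "real^'n^'n"
  assumes A: "A \<in> spd_matrices"
  shows "continuous_on spd_matrices (geo_mean A)"
  unfolding geo_mean_def
  by (intro continuous_on_matrix_mult continuous_intros continuous_on_mat_sqrt_congruence
      spd_inverse mat_sqrt_spd A)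

lemma continuous_on_W2_sq:
  fixes A :: "real^'n^'n"
  assumes A: "A \<in> spd_matrices"
  shows "continuous_on spd_matrices (W2_sq A)"
  unfolding W2_sq_def
  by (intro bounded_linear.continuous_on[OF bounded_linear_trace] continuous_intros
      continuous_on_mat_sqrt_congruence mat_sqrt_spd A)

lemma W2_eps_sq:
  assumes "A \<in> spd_matrices" "B \<in> spd_matrices"
  shows "(W2_eps \<epsilon> A B)\<^sup>2 = W2_sq A B + \<epsilon>\<^sup>2"
  using W2_sq_nonneg[OF assms] by (simp add: W2_eps_def)

lemma W2_eps_ge:
  assumes "A \<in> spd_matrices" "B \<in> spd_matrices"
  shows "\<epsilon> \<le> W2_eps \<epsilon> A B"
  unfolding W2_eps_def using W2_sq_nonneg[OF assms] by (intro real_le_rsqrt) simp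

section \<open>The smoothed objective and its gradient\<close>

definition descent_field :: "real \<Rightarrow> real^'n^'n \<Rightarrow> real^'n^'n \<Rightarrow> real^'n^'n" where
  "descent_field \<epsilon> A B = (1 / W2_eps \<epsilon> A B) *\<^sub>R (geo_mean (matrix_inv A) B - mat 1)"

locale spd_distribution = prob_space P for P :: "(real^'n^'n) measure" +
  assumes sets_P: "sets P = sets (restrict_space borel spd_matrices)"
begin

lemma space_P: "space P = spd_matrices"
  using sets_eq_imp_space_eq[OF sets_P] by (simp add: space_restrict_space)

lemma borel_measurable_P_continuous:
  "continuous_on spd_matrices f \<Longrightarrow> f \<in> borel_measurable P"
  using borel_measurable_continuous_on_restrict measurable_cong_sets[OF sets_P refl] by blast

lemma measurable_W2_eps [measurable]:
  "A \<in> spd_matrices \<Longrightarrow> W2_eps \<epsilon> A \<in> borel_measurable P"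
  unfolding W2_eps_def
  by (intro borel_measurable_P_continuous continuous_intros continuous_on_W2_sq)

lemma median_grad_eq: "median_grad P \<epsilon> A = - (\<integral>B. descent_field \<epsilon> A B \<partial>P)"
  by (simp add: median_grad_def descent_field_def)

text \<open>The integrand is bounded: the smoothed distance in the denominator dominates the displacement, up to
a constant that depends on the smallest eigenvalue of \<open>A\<close>.\<close>

lemma integrable_descent_field:
  assumes A: "A \<in> spd_matrices" and eps: "\<epsilon> > 0"
  shows "integrable P (descent_field \<epsilon> A)"
proof -
  obtain m where m: "m > 0" "\<And>x. m * (norm x)\<^sup>2 \<le> x \<bullet> (A *v x)"
    using spd_lower_bound[OF A] by blast
  have [measurable]: "geo_mean (matrix_inv A) \<in> borel_measurable P"
    by (intro borel_measurable_P_continuous continuous_on_geo_mean spd_inverse A)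
  note measurable_W2_eps[OF A, measurable]
  show ?thesis
  proof (rule integrable_const_bound[where B = "1 / sqrt m"])
    show "descent_field \<epsilon> A \<in> borel_measurable P"
      unfolding descent_field_def by measurable
    have "norm (descent_field \<epsilon> A B) \<le> 1 / sqrt m" if B: "B \<in> spd_matrices" for B
    proof -
      let ?W = "W2_eps \<epsilon> A B" and ?d = "norm (geo_mean (matrix_inv A) B - mat 1)"
      have W: "?W > 0" using W2_eps_ge[OF A B, of \<epsilon>] eps by simp
      have "(sqrt m * ?d)\<^sup>2 \<le> ?W\<^sup>2"
        using geo_mean_distance_bound[OF A B m(2)] m(1)
        by (simp add: power_mult_distrib W2_eps_sq[OF A B] add_increasing2)
      then have "sqrt m * ?d \<le> ?W" using W by (auto intro: power2_le_imp_le)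
      then show ?thesis using W m(1) by (simp add: descent_field_def pos_divide_le_eq pos_le_divide_eq mult.commute)
    qed
    then show "AE B in P. norm (descent_field \<epsilon> A B) \<le> 1 / sqrt m"
      by (intro AE_I2) (simp add: space_P)
  qed
qed

lemma median_grad_symmetric:
  assumes A: "A \<in> spd_matrices" and eps: "\<epsilon> > 0"
  shows "transpose (median_grad P \<epsilon> A) = median_grad P \<epsilon> A"
proof -
  have "transpose (\<integral>B. descent_field \<epsilon> A B \<partial>P) = (\<integral>B. transpose (descent_field \<epsilon> A B) \<partial>P)"
    by (rule integral_bounded_linear[OF bounded_linear_transpose integrable_descent_field[OF assms], symmetric])
  also have "\<dots> = (\<integral>B. descent_field \<epsilon> A B \<partial>P)"
    by (rule Bochner_Integration.integral_cong[OF refl])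
      (simp add: space_P descent_field_def transpose_scalar transpose_diff
        spd_symmetric[OF transport_map(1)[OF A]])
  finally show ?thesis
    using transpose_scalar[of "-1" "\<integral>B. descent_field \<epsilon> A B \<partial>P"] by (simp add: median_grad_eq)
qed

text \<open>The factor is the mean over \<open>B\<close> of \<open>(1 - \<eta> / W) I + (\<eta> / W) T\<close>, where \<open>W\<close> is the smoothed distance to
\<open>B\<close> and \<open>T\<close> the optimal map. As \<open>\<eta> \<le> \<epsilon> \<le> W\<close>, this is a convex combination of \<open>I\<close> and a positive definite
matrix with a positive weight on the latter.\<close>

lemma gd_factor_spd:
  assumes A: "A \<in> spd_matrices" and eps: "0 < \<eta>" "\<eta> \<le> \<epsilon>"
  shows "gd_factor P \<epsilon> \<eta> A \<in> spd_matrices"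
proof -
  have eps0: "\<epsilon> > 0" using eps by simp
  note int = integrable_descent_field[OF A eps0]
  have "0 < x \<bullet> (gd_factor P \<epsilon> \<eta> A *v x)" if x: "x \<noteq> 0" for x
  proof -
    have lin: "bounded_linear (\<lambda>M :: real^'n^'n. x \<bullet> (M *v x))"
      unfolding linear_conv_bounded_linear[symmetric]
      by (auto intro!: linearI simp: matrix_vector_mult_add_rdistrib inner_add_right
          scaleR_matrix_vector_assoc[symmetric])
    let ?h = "\<lambda>B. x \<bullet> x + \<eta> * (x \<bullet> (descent_field \<epsilon> A B *v x))"
    have int': "integrable P (\<lambda>B. x \<bullet> (descent_field \<epsilon> A B *v x))"
      by (rule integrable_bounded_linear[OF lin int])
    have pos: "0 < ?h B" if B: "B \<in> spd_matrices" for B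
    proof -
      let ?W = "W2_eps \<epsilon> A B" and ?T = "geo_mean (matrix_inv A) B"
      have W: "\<epsilon> \<le> ?W" by (rule W2_eps_ge[OF A B])
      have "?h B = (1 - \<eta> / ?W) * (x \<bullet> x) + \<eta> / ?W * (x \<bullet> (?T *v x))"
        by (simp add: descent_field_def scaleR_matrix_vector_assoc[symmetric]
            matrix_vector_mult_diff_rdistrib algebra_simps diff_divide_distrib)
      moreover have "0 \<le> (1 - \<eta> / ?W) * (x \<bullet> x)" using W eps by simp
      moreover have "0 < \<eta> / ?W * (x \<bullet> (?T *v x))"
        using W eps spd_pos[OF transport_map(1)[OF A B] x] by simp
      ultimately show ?thesis by simp
    qed
    have "(\<integral>B. 0 \<partial>P) < (\<integral>B. ?h B \<partial>P)"
      using pos by (intro integral_less_AE_space AE_I2 Bochner_Integration.integrable_add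
          integrable_const integrable_mult_right int')
        (auto simp: space_P emeasure_space_1[unfolded space_P])
    also have "(\<integral>B. ?h B \<partial>P) = x \<bullet> x + \<eta> * (\<integral>B. x \<bullet> (descent_field \<epsilon> A B *v x) \<partial>P)"
      using int' by (simp add: prob_space)
    also have "(\<integral>B. x \<bullet> (descent_field \<epsilon> A B *v x) \<partial>P) = x \<bullet> ((\<integral>B. descent_field \<epsilon> A B \<partial>P) *v x)"
      by (rule integral_bounded_linear[OF lin int])
    finally show ?thesis
      by (simp add: gd_factor_def median_grad_eq matrix_vector_mult_add_rdistrib inner_add_right
          scaleR_matrix_vector_assoc[symmetric])
  qed
  moreover have "transpose (gd_factor P \<epsilon> \<eta> A) = gd_factor P \<epsilon> \<eta> A"
    by (simp add: gd_factor_def transpose_diff transpose_scalar median_grad_symmetric[OF A eps0])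
  ultimately show ?thesis by (simp add: spd_matrices_def)
qed

text \<open>The map \<open>T\<close> from \<open>A\<close> to \<open>B\<close> and the factor \<open>S = I - \<eta> G\<close> give a coupling of \<open>S A S\<close> and \<open>B\<close> whose cost is
quadratic in \<open>\<eta>\<close>. The square root is concave, \<open>W' \<le> W + (W'\<^sup>2 - W\<^sup>2) / (2 W)\<close>, and smoothing bounds the
coefficient of the quadratic term, \<open>1 / W \<le> 1 / \<epsilon>\<close>.\<close>

lemma W2_eps_descent:
  fixes \<eta> \<epsilon> :: real
  assumes A: "A \<in> spd_matrices" and B: "B \<in> spd_matrices" and eps: "0 < \<eta>" "\<eta> \<le> \<epsilon>"
  defines "G \<equiv> median_grad P \<epsilon> A" and "S \<equiv> gd_factor P \<epsilon> \<eta> A"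
  shows "W2_eps \<epsilon> (S ** A ** S) B \<le> W2_eps \<epsilon> A B
    + \<eta> * trace (descent_field \<epsilon> A B ** A ** G) + \<eta>\<^sup>2 / (2 * \<epsilon>) * (bw_norm A G)\<^sup>2"
proof -
  define W where "W = W2_eps \<epsilon> A B"
  define W' where "W' = W2_eps \<epsilon> (S ** A ** S) B"
  define D where "D = geo_mean (matrix_inv A) B - mat 1"
  define g where "g = trace (G ** A ** G)"
  define h where "h = trace (D ** A ** G)"
  have eps0: "\<epsilon> > 0" using eps by simp
  have W: "\<epsilon> \<le> W" unfolding W_def by (rule W2_eps_ge[OF A B])
  have S: "S \<in> spd_matrices" unfolding S_def by (rule gd_factor_spd[OF A eps])
  note T = transport_map[OF A B]
  have Dt: "transpose D = D" by (simp add: D_def transpose_diff spd_symmetric[OF T(1)])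
  have Gt: "transpose G = G" unfolding G_def by (rule median_grad_symmetric[OF A eps0])
  have g0: "0 \<le> g" using trace_congruence_nonneg[of A G] spd_nonneg[OF A] Gt by (simp add: g_def)
  have g: "(bw_norm A G)\<^sup>2 = g" using g0 by (simp add: bw_norm_def g_def)
  have DS: "geo_mean (matrix_inv A) B - S = D - (- \<eta>) *\<^sub>R G"
    by (simp add: S_def gd_factor_def D_def G_def)
  have "W'\<^sup>2 \<le> trace ((D - (- \<eta>) *\<^sub>R G) ** A ** (D - (- \<eta>) *\<^sub>R G)) + \<epsilon>\<^sup>2"
    using W2_sq_coupling[OF A S T(1)] W2_eps_sq[OF spd_congruence[OF A S] B, of \<epsilon>]
    by (simp add: T(2) DS W'_def)
  also have "\<dots> = trace (D ** A ** D) + \<eta>\<^sup>2 * g + 2 * \<eta> * trace (G ** A ** D) + \<epsilon>\<^sup>2"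
    using Gt Dt spd_symmetric[OF A]
    by (subst trace_diff_congruence) (simp_all add: transpose_scalar matrix_mult_scaleR_left
        matrix_mult_scaleR_right matrix_mult_minus_left scaleR_minus_left[symmetric]
        trace_scaleR g_def power2_eq_square del: scaleR_minus_left)
  also have "trace (G ** A ** D) = h"
    using trace_transpose[of "G ** A ** D"] Gt Dt spd_symmetric[OF A]
    by (simp add: matrix_transpose_mul matrix_mul_assoc h_def)
  also have "trace (D ** A ** D) = W\<^sup>2 - \<epsilon>\<^sup>2"
    using W2_sq_eq[OF A B] W2_eps_sq[OF A B] by (simp add: W_def D_def)
  finally have sq: "W'\<^sup>2 \<le> W\<^sup>2 + \<eta>\<^sup>2 * g + 2 * \<eta> * h" by simp
  \<comment> \<open>Concavity of the square root, in the form \<open>2 * W * W' \<le> W\<^sup>2 + W'\<^sup>2\<close>.\<close>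
  have "0 \<le> (W' - W)\<^sup>2" by simp
  with sq have "2 * W * W' \<le> 2 * W * (W + \<eta> * (h / W) + \<eta>\<^sup>2 * g / (2 * W))"
    using W eps0 by (simp add: power2_eq_square algebra_simps)
  then have "W' \<le> W + \<eta> * (h / W) + \<eta>\<^sup>2 * g / (2 * W)"
    using W eps0 by (simp add: mult_le_cancel_left_pos)
  also have "\<dots> \<le> W + \<eta> * (h / W) + \<eta>\<^sup>2 * g / (2 * \<epsilon>)"
    using W eps0 g0 by (intro add_left_mono divide_left_mono) auto
  finally show ?thesis
    by (simp add: W'_def W_def g descent_field_def matrix_mult_scaleR_left trace_scaleR
        h_def D_def[symmetric])
qed

text \<open>On integrating the pointwise bound over \<open>B\<close>, the linear term becomes \<open>- \<eta> \<parallel>G\<parallel>\<^sup>2\<close>, because \<open>- G\<close> is the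
mean of the descent field. Writing the gain on the left-hand side keeps the inequality meaningful
when the objective is infinite.\<close>

lemma median_obj_descent:
  assumes A: "A \<in> spd_matrices" and eps: "0 < \<eta>" "\<eta> \<le> \<epsilon>"
  defines "G \<equiv> median_grad P \<epsilon> A" and "S \<equiv> gd_factor P \<epsilon> \<eta> A"
  shows "median_obj P \<epsilon> (S ** A ** S) + ennreal (\<eta> * (1 - \<eta> / (2 * \<epsilon>)) * (bw_norm A G)\<^sup>2)
    \<le> median_obj P \<epsilon> A"
proof (cases "median_obj P \<epsilon> A = \<infinity>")
  case False
  have eps0: "\<epsilon> > 0" using eps by simp
  let ?A' = "S ** A ** S" and ?W = "W2_eps \<epsilon> A" and ?g = "(bw_norm A G)\<^sup>2"
  have A': "?A' \<in> spd_matrices"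
    unfolding S_def by (intro spd_congruence gd_factor_spd A eps)
  have W0: "0 \<le> W2_eps \<epsilon> M B" if "M \<in> spd_matrices" "B \<in> spd_matrices" for M B
    using W2_eps_ge[OF that, of \<epsilon>] eps0 by simp
  have int_W: "integrable P ?W"
    using False W0[OF A]
    by (intro integrableI_nonneg measurable_W2_eps A AE_I2)
      (auto simp: median_obj_def space_P less_top)
  have lin: "bounded_linear (\<lambda>M. trace (M ** A ** G))"
    by (intro bounded_linear_compose[OF bounded_linear_trace]
        bounded_linear_compose[OF bounded_bilinear.bounded_linear_left[OF bounded_bilinear_matrix_mult]]
        bounded_bilinear.bounded_linear_left[OF bounded_bilinear_matrix_mult])
  note int = integrable_descent_field[OF A eps0]
  have int_tr: "integrable P (\<lambda>B. trace (descent_field \<epsilon> A B ** A ** G))"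
    by (rule integrable_bounded_linear[OF lin int])
  let ?r = "\<lambda>B. ?W B + \<eta> * trace (descent_field \<epsilon> A B ** A ** G) + \<eta>\<^sup>2 / (2 * \<epsilon>) * ?g"
  have le: "W2_eps \<epsilon> ?A' B \<le> ?r B" if "B \<in> spd_matrices" for B
    unfolding G_def S_def by (rule W2_eps_descent[OF A that eps])
  then have r0: "0 \<le> ?r B" if "B \<in> spd_matrices" for B
    using W0[OF A' that] that by force
  have int_r: "integrable P ?r" using int_W int_tr by simp
  have Gt: "transpose G = G" unfolding G_def by (rule median_grad_symmetric[OF A eps0])
  have "(\<integral>B. trace (descent_field \<epsilon> A B ** A ** G) \<partial>P) = trace ((- G) ** A ** G)"
    using integral_bounded_linear[OF lin int] by (simp add: G_def median_grad_eq)
  also have "\<dots> = - ?g"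
    using trace_congruence_nonneg[of A G] spd_nonneg[OF A] Gt trace_scaleR[of "-1" "G ** A ** G"]
    by (simp add: bw_norm_def matrix_mult_minus_left)
  finally have I: "(\<integral>B. ?r B \<partial>P) = (\<integral>B. ?W B \<partial>P) - \<eta> * (1 - \<eta> / (2 * \<epsilon>)) * ?g"
    using int_W int_tr by (simp add: prob_space algebra_simps power2_eq_square)
  have "median_obj P \<epsilon> ?A' \<le> (\<integral>\<^sup>+B. ennreal (?r B) \<partial>P)"
    unfolding median_obj_def using le by (intro nn_integral_mono ennreal_leI) (simp add: space_P)
  also have "\<dots> = ennreal (\<integral>B. ?r B \<partial>P)"
    using r0 by (intro nn_integral_eq_integral int_r AE_I2) (simp add: space_P)
  finally have "median_obj P \<epsilon> ?A' + ennreal (\<eta> * (1 - \<eta> / (2 * \<epsilon>)) * ?g)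
      \<le> ennreal (\<integral>B. ?r B \<partial>P) + ennreal (\<eta> * (1 - \<eta> / (2 * \<epsilon>)) * ?g)"
    by (rule add_right_mono)
  also have "\<dots> = ennreal (\<integral>B. ?W B \<partial>P)"
  proof -
    have "0 \<le> (\<integral>B. ?r B \<partial>P)"
      using r0 by (intro integral_nonneg_AE AE_I2) (simp add: space_P)
    moreover have "0 \<le> 1 - \<eta> / (2 * \<epsilon>)" using eps by (simp add: field_simps)
    then have "0 \<le> \<eta> * (1 - \<eta> / (2 * \<epsilon>)) * ?g" using eps by (intro mult_nonneg_nonneg) auto
    ultimately show ?thesis unfolding I by (subst ennreal_plus[symmetric]) simp_all
  qed
  also have "\<dots> = median_obj P \<epsilon> A"
    unfolding median_obj_def using W0[OF A]
    by (intro nn_integral_eq_integral[symmetric] int_W AE_I2) (simp add: space_P)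
  finally show ?thesis .
qed simp

lemma gd_iter_spd:
  assumes "A \<in> spd_matrices" "0 < \<eta>" "\<eta> \<le> \<epsilon>"
  shows "gd_iter P \<epsilon> \<eta> A t \<in> spd_matrices"
  by (induction t) (auto intro!: spd_congruence gd_factor_spd assms)

lemma median_obj_telescope:
  assumes A: "A \<in> spd_matrices" and eps: "0 < \<eta>" "\<eta> \<le> \<epsilon>"
  defines "X \<equiv> gd_iter P \<epsilon> \<eta> A"
  shows "median_obj P \<epsilon> (X n)
    + (\<Sum>t<n. ennreal (\<eta> * (1 - \<eta> / (2 * \<epsilon>)) * (bw_norm (X t) (median_grad P \<epsilon> (X t)))\<^sup>2))
    \<le> median_obj P \<epsilon> A"
proof (induction n)
  case (Suc n)
  let ?a = "\<lambda>t. ennreal (\<eta> * (1 - \<eta> / (2 * \<epsilon>)) * (bw_norm (X t) (median_grad P \<epsilon> (X t)))\<^sup>2)"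
  have "X n \<in> spd_matrices" unfolding X_def by (rule gd_iter_spd[OF A eps])
  from median_obj_descent[OF this eps] have "median_obj P \<epsilon> (X (Suc n)) + ?a n \<le> median_obj P \<epsilon> (X n)"
    by (simp add: X_def)
  then have "median_obj P \<epsilon> (X (Suc n)) + ?a n + (\<Sum>t<n. ?a t) \<le> median_obj P \<epsilon> (X n) + (\<Sum>t<n. ?a t)"
    by (rule add_right_mono)
  also note Suc
  finally show ?case by (simp add: ac_simps)
qed (simp add: X_def)

end

section \<open>Convergence to an approximate critical point\<close>

theorem theorem5:
  fixes P :: "(real^'n^'n) measure" and \<epsilon> :: real and \<Sigma>0 :: "real^'n^'n" and T :: nat
  assumes "prob_space P"
    and "sets P = sets (restrict_space borel spd_matrices)"
    and "\<epsilon> > 0"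
    and "\<Sigma>0 \<in> measure_supp P"
    and "ennreal (real T) \<ge> 2 * median_obj P \<epsilon> \<Sigma>0 / ennreal (\<epsilon> ^ 3)"
  shows "(MIN t\<in>{0..T}. bw_norm (gd_iter P \<epsilon> \<epsilon> \<Sigma>0 t)
            (median_grad P \<epsilon> (gd_iter P \<epsilon> \<epsilon> \<Sigma>0 t))) \<le> \<epsilon>"
proof (rule ccontr)
  interpret prob_space P by fact
  interpret spd_distribution P by unfold_locales fact
  define b where "b t = bw_norm (gd_iter P \<epsilon> \<epsilon> \<Sigma>0 t) (median_grad P \<epsilon> (gd_iter P \<epsilon> \<epsilon> \<Sigma>0 t))" for t
  have spd: "\<Sigma>0 \<in> spd_matrices" using assms(4) by (simp add: measure_supp_def space_P)
  assume "\<not> ?thesis"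
  then have b: "\<epsilon> < b t" if "t \<le> T" for t
    using that by (simp add: b_def[symmetric] not_le)
  \<comment> \<open>The gain \<open>\<eta> * (1 - \<eta> / (2 * \<epsilon>))\<close> is \<open>\<epsilon> / 2\<close> for \<open>\<eta> = \<epsilon>\<close>; summing over \<open>T + 1\<close> steps instead of \<open>T\<close>
    makes the final comparison strict.\<close>
  have "ennreal (real (Suc T) * (\<epsilon> ^ 3 / 2)) = (\<Sum>t<Suc T. ennreal (\<epsilon> ^ 3 / 2))"
    using ennreal_mult'[of "real (Suc T)" "\<epsilon> ^ 3 / 2"] assms(3)
    by (simp add: ennreal_of_nat_eq_real_of_nat del: of_nat_Suc times_divide_eq_right)
  also have "\<dots> \<le> (\<Sum>t<Suc T. ennreal (\<epsilon> * (1 - \<epsilon> / (2 * \<epsilon>)) * (b t)\<^sup>2))"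
  proof (intro sum_mono ennreal_leI)
    fix t assume "t \<in> {..<Suc T}"
    then have "\<epsilon>\<^sup>2 \<le> (b t)\<^sup>2" using b[of t] assms(3) by (intro power_mono) auto
    then have "\<epsilon> / 2 * \<epsilon>\<^sup>2 \<le> \<epsilon> / 2 * (b t)\<^sup>2" using assms(3) by (intro mult_left_mono) auto
    then show "\<epsilon> ^ 3 / 2 \<le> \<epsilon> * (1 - \<epsilon> / (2 * \<epsilon>)) * (b t)\<^sup>2"
      using assms(3) by (simp add: power3_eq_cube power2_eq_square)
  qed
  also have "\<dots> \<le> median_obj P \<epsilon> \<Sigma>0"
    using median_obj_telescope[OF spd assms(3) order_refl, of "Suc T", folded b_def]
    by (rule order_trans[rotated]) simp
  finally have "2 * ennreal (real (Suc T) * (\<epsilon> ^ 3 / 2)) / ennreal (\<epsilon> ^ 3)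
      \<le> 2 * median_obj P \<epsilon> \<Sigma>0 / ennreal (\<epsilon> ^ 3)"
    by (intro divide_right_mono_ennreal mult_left_mono) auto
  also have "\<dots> \<le> ennreal (real T)" by fact
  also have "2 * ennreal (real (Suc T) * (\<epsilon> ^ 3 / 2)) / ennreal (\<epsilon> ^ 3) = ennreal (real (Suc T))"
  proof -
    have "2 * ennreal (real (Suc T) * (\<epsilon> ^ 3 / 2)) = ennreal (real (Suc T) * \<epsilon> ^ 3)"
      using assms(3) by (subst ennreal_numeral[symmetric], subst ennreal_mult[symmetric]) auto
    then show ?thesis using assms(3) by (simp add: divide_ennreal del: of_nat_Suc)
  qed
  finally show False by simp
qed

end
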